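(* Let $n\ge 1$ and let $B$ be a nondegenerate complex quadratic form in $n$ variables $z_1,\dots,z_n$. Then the point $O=\left(\frac{2}{n},\dots,\frac{2}{n}\right)\in\mathbb{R}^n$ belongs to the Newton polytope $N(B)$.
   Context: For a polynomial $p=\sum_{k} a_k z_1^{k_1}\cdots z_n^{k_n}\in\mathbb{C}[z_1,\dots,z_n]$, its Newton polytope is $N(p)=\operatorname{conv}\{k\in\mathbb{Z}^n \mid a_k\neq 0\}\subset\mathbb{R}^n$. A quadratic form $B=\sum_{i,j} B_{ij}z_iz_j$ with symmetric matrix $(B_{ij})$ is nondegenerate if $\det(B_{ij})\neq 0$. *)

theory Defs
  imports "HOL-Analysis.Analysis" "HOL-Library.Poly_Mapping"
begin

text \<open>
  A polynomial over \<open>\<complex>\<close> in variables indexed by \<open>'n\<close> is a finitely supported map from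
  multi-exponents to coefficients; the ring operations are those of \<^theory>\<open>HOL-Library.Poly_Mapping\<close>.
\<close>

type_synonym 'n cpoly = "('n \<Rightarrow>\<^sub>0 nat) \<Rightarrow>\<^sub>0 complex"

definition poly_var :: "'n \<Rightarrow> 'n cpoly"
  where "poly_var i = Poly_Mapping.single (Poly_Mapping.single i 1) 1"

definition poly_const :: "complex \<Rightarrow> 'n cpoly"
  where "poly_const c = Poly_Mapping.single 0 c"

definition exponent_vec :: "('n::finite \<Rightarrow>\<^sub>0 nat) \<Rightarrow> real ^ 'n"
  where "exponent_vec k = (\<chi> i. real (Poly_Mapping.lookup k i))"

definition newton_polytope :: "'n::finite cpoly \<Rightarrow> (real ^ 'n) set"
  where "newton_polytope p = convex hull {exponent_vec k | k. Poly_Mapping.lookup p k \<noteq> 0}"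

definition quadratic_form :: "complex ^ 'n ^ 'n \<Rightarrow> 'n::finite cpoly"
  where "quadratic_form A = (\<Sum>i\<in>UNIV. \<Sum>j\<in>UNIV. poly_const (A $ i $ j) * poly_var i * poly_var j)"

end

theory Submission imports Defs begin

text \<open>
  Some Leibniz term of the determinant is nonzero, so there is a permutation \<open>p\<close> with
  \<open>A $ i $ p i \<noteq> 0\<close> for all \<open>i\<close>. By symmetry of \<open>A\<close> the contributions to the coefficient of
  the product of the variables \<open>i\<close> and \<open>p i\<close> do not cancel, so this monomial occurs in the form. The
  barycentre of the exponents of these monomials has all coordinates \<open>2 / n\<close>.
\<close>

text \<open>Comparing exponents at \<open>i\<close> forces \<open>i\<close> to be \<open>a\<close>
  or \<open>b\<close>; comparing them at \<open>j\<close> then settles the other index. Repeated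
  indices are covered, since multiplicities are compared.\<close>

lemma single_add_single_eq_iff:
  fixes i j a b :: 'n
  shows "Poly_Mapping.single i (1::nat) + Poly_Mapping.single j 1
           = Poly_Mapping.single a 1 + Poly_Mapping.single b 1
         \<longleftrightarrow> (i = a \<and> j = b) \<or> (i = b \<and> j = a)" (is "?l = ?r \<longleftrightarrow> _")
proof
  assume eq: "?l = ?r"
  have *: "(if i = x then 1 else 0) + (if j = x then 1 else 0)
      = (if a = x then 1 else 0) + (if b = x then (1::nat) else 0)" for x
    using arg_cong[OF eq, of "\<lambda>q. Poly_Mapping.lookup q x"]
    by (simp only: lookup_add lookup_single when_def)
  have "i = a \<or> i = b"
    using *[of i] by (simp split: if_splits)
  then show "(i = a \<and> j = b) \<or> (i = b \<and> j = a)"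
  proof
    assume "i = a"
    then show ?thesis
      using *[of j] by (simp split: if_splits)
  next
    assume "i = b"
    then show ?thesis
      using *[of j] by (simp split: if_splits)
  qed
qed (auto simp: add.commute)

lemma lookup_quadratic_form:
  "Poly_Mapping.lookup (quadratic_form A) k =
     (\<Sum>i\<in>UNIV. \<Sum>j\<in>UNIV. A $ i $ j when Poly_Mapping.single i 1 + Poly_Mapping.single j 1 = k)"
  by (simp add: quadratic_form_def poly_const_def poly_var_def mult_single lookup_sum lookup_single)

lemma lookup_quadratic_form_nonzero:
  fixes A :: "complex ^ 'n ^ 'n"
  assumes "transpose A = A" and "A $ a $ b \<noteq> 0"
  shows "Poly_Mapping.lookup (quadratic_form A)
           (Poly_Mapping.single a 1 + Poly_Mapping.single b 1) \<noteq> 0"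
proof -
  \<comment> \<open>As a set, \<open>S\<close> collapses to one pair when \<open>a = b\<close>.
    Squares and mixed monomials are thus treated together: the coefficient is \<open>card S\<close>
    times the entry, with \<open>card S\<close> equal to 1 or 2, hence nonzero in characteristic
    0.\<close>
  define S where "S = {(a, b), (b, a)}"
  have sym: "A $ b $ a = A $ a $ b"
    using arg_cong[OF assms(1), of "\<lambda>M. M $ a $ b"] by (simp add: transpose_def)
  have "Poly_Mapping.lookup (quadratic_form A) (Poly_Mapping.single a 1 + Poly_Mapping.single b 1)
      = (\<Sum>(i, j)\<in>UNIV. if (i, j) \<in> S then A $ i $ j else 0)"
    unfolding lookup_quadratic_form sum.cartesian_product single_add_single_eq_iff
    by (intro sum.cong) (auto simp: S_def when_def)
  also have "\<dots> = (\<Sum>(i, j)\<in>S. A $ i $ j)"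
    by (rule sum.mono_neutral_cong_right) (auto simp: S_def split: if_split_asm)
  also have "\<dots> = (\<Sum>x\<in>S. A $ a $ b)"
    by (intro sum.cong) (auto simp: S_def sym)
  also have "\<dots> = of_nat (card S) * A $ a $ b"
    by simp
  finally show ?thesis
    using assms(2) by (simp add: S_def card_eq_0_iff)
qed

lemma det_nonzero_imp_permutation:
  fixes A :: "'a::comm_ring_1 ^ 'n ^ 'n"
  assumes "det A \<noteq> 0"
  obtains p where "p permutes UNIV" and "\<forall>i. A $ i $ p i \<noteq> 0"
proof -
  obtain p where "p permutes UNIV" and "of_int (sign p) * (\<Prod>i\<in>UNIV. A $ i $ p i) \<noteq> 0"
    using assms unfolding det_def by (metis (mono_tags, lifting) mem_Collect_eq sum.neutral)
  moreover from this(2) have "A $ i $ p i \<noteq> 0" for i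
    by (metis finite UNIV_I mult_zero_right prod_zero)
  ultimately show ?thesis
    using that by blast
qed

theorem theorem1:
  fixes A :: "complex ^ 'n ^ 'n"
  assumes "transpose A = A"
    and "det A \<noteq> 0"
  shows "(\<chi> i. 2 / real CARD('n)) \<in> newton_polytope (quadratic_form A)"
proof -
  obtain p where p: "p permutes UNIV" "\<forall>i. A $ i $ p i \<noteq> 0"
    using det_nonzero_imp_permutation[OF assms(2)] by blast
  define e where "e i = exponent_vec (Poly_Mapping.single i 1 + Poly_Mapping.single (p i) 1)" for i
  \<comment> \<open>Writing the condition \<open>p i = x\<close> as \<open>i = inv p x\<close> makes
    both terms indicators of a single \<open>i\<close>, so summing over \<open>i\<close> gives
    exactly 2 in every coordinate.\<close>
  have e_nth: "e i $ x = (if i = x then 1 else 0) + (if i = inv p x then 1 else 0)" for i x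
    using permutes_inv_eq[OF p(1), of x i]
    by (simp add: e_def exponent_vec_def lookup_add lookup_single when_def eq_commute[of i "inv p x"])
  have "(\<Sum>i\<in>UNIV. (1 / real CARD('n)) *\<^sub>R e i) \<in> newton_polytope (quadratic_form A)"
    unfolding newton_polytope_def
  \<comment> \<open>The points \<open>e i\<close> may coincide, for instance along a 2-cycle of
    \<open>p\<close>; weighting by the index \<open>i\<close> rather than by the point keeps the
    total weight 1.\<close>
  proof (rule convex_sum)
    show "e i \<in> convex hull {exponent_vec k |k. Poly_Mapping.lookup (quadratic_form A) k \<noteq> 0}" for i
      using lookup_quadratic_form_nonzero[OF assms(1) p(2)[rule_format, of i]]
      by (intro hull_inc) (auto simp: e_def)
  qed auto
  also have "(\<Sum>i\<in>UNIV. (1 / real CARD('n)) *\<^sub>R e i) = (\<chi> i. 2 / real CARD('n))"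
    by (simp add: vec_eq_iff e_nth sum.distrib add_divide_distrib flip: sum_divide_distrib)
  finally show ?thesis .
qed

end
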